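(* Consider online Nash welfare maximization with $N$ agents and divisible items arriving online, and let $\mu^*$ denote the impartiality ratio of the instance (not known to the algorithm). The following randomized online algorithm is $O\big(\log(\mu^* N)\,(\log\log (\mu^* N))^2\big)$-competitive: before any item arrives, sample a non-negative integer $k$ with probability $\frac{6}{\pi^2}\cdot\frac{1}{(k+1)^2}$, set $\lambda = 2^{2^k}$, and then run the Half-and-Half algorithm with parameter $\lambda$ to allocate all items.
   Context: There are $N$ agents and $T$ divisible items arriving online in the order $t=1,\dots,T$. Item $t$ has supply $s_t>0$ and agent $i$ has value $v_{it}\ge 0$ per unit of item $t$. An allocation is a non-negative vector $(x_{it})$ with $\sum_{i} x_{it}\le s_t$ for every $t$; agent $i$'s utility is $u_i=\sum_t x_{it}v_{it}$, and the Nash welfare is $(\prod_{i=1}^N u_i)^{1/N}$. When item $t$ arrives, an online algorithm observes $s_t$ and $(v_{it})_{i}$ and must irrevocably decide how to allocate item $t$. An algorithm is $\Gamma$-competitive if on every instance, the optimal (offline) Nash welfare is at most $\Gamma$ times the expected Nash welfare of the algorithm's allocation. An allocation with utilities $(u_i)$ is $\mu$-impartial if $u_i\le \mu u_j$ for all agents $i,j$; an instance is $\mu$-impartial if every Nash welfare maximizing allocation is $\mu$-impartial; the impartiality ratio $\mu^*$ is the smallest $\mu$ for which the instance is $\mu$-impartial. Logarithms are natural. Half-and-Half with parameter $\lambda$: for each item $t$ in order, let $y_{it}=\frac{s_t}{2N}$ for all $i$; define $u'_{it}=\frac{1}{2\lambda N^2}\sum_{j=1}^N\sum_{t'=1}^{t}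 v_{jt'}s_{t'}+\sum_{t'=1}^{t-1} v_{it'}z_{it'}$; let $(z_{it})_i$ maximize $\sum_{i=1}^N\log(u'_{it}+v_{it}z_{it})$ subject to $\sum_i z_{it}\le s_t/2$ and $z_{it}\ge 0$; allocate $x_{it}=y_{it}+z_{it}$ to each agent $i$. *)

theory Defs
  imports "HOL-Analysis.Analysis" "HOL-Probability.Probability"
begin

(* Agents are 0, ..., N - 1 and items are 0, ..., T - 1.  The supply of item t is s t, the
   value of agent i per unit of item t is v i t, and x i t is the amount of item t that
   agent i receives.  Values of s, v, x outside these index ranges never matter. *)

definition nw_instance ::
  "nat \<Rightarrow> nat \<Rightarrow> (nat \<Rightarrow> real) \<Rightarrow> (nat \<Rightarrow> nat \<Rightarrow> real) \<Rightarrow> bool" where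
  "nw_instance N T s v \<longleftrightarrow>
     N \<ge> 1 \<and> (\<forall>t<T. s t > 0) \<and> (\<forall>i<N. \<forall>t<T. v i t \<ge> 0)"

definition feasible ::
  "nat \<Rightarrow> nat \<Rightarrow> (nat \<Rightarrow> real) \<Rightarrow> (nat \<Rightarrow> nat \<Rightarrow> real) \<Rightarrow> bool" where
  "feasible N T s x \<longleftrightarrow>
     (\<forall>i<N. \<forall>t<T. x i t \<ge> 0) \<and> (\<forall>t<T. (\<Sum>i<N. x i t) \<le> s t)"

definition utility ::
  "nat \<Rightarrow> (nat \<Rightarrow> nat \<Rightarrow> real) \<Rightarrow> (nat \<Rightarrow> nat \<Rightarrow> real) \<Rightarrow> nat \<Rightarrow> real" where
  "utility T v x i = (\<Sum>t<T. x i t * v i t)"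

definition nash_welfare ::
  "nat \<Rightarrow> nat \<Rightarrow> (nat \<Rightarrow> nat \<Rightarrow> real) \<Rightarrow> (nat \<Rightarrow> nat \<Rightarrow> real) \<Rightarrow> real" where
  "nash_welfare N T v x = root N (\<Prod>i<N. utility T v x i)"

definition opt_nash_welfare ::
  "nat \<Rightarrow> nat \<Rightarrow> (nat \<Rightarrow> real) \<Rightarrow> (nat \<Rightarrow> nat \<Rightarrow> real) \<Rightarrow> real" where
  "opt_nash_welfare N T s v = (SUP x\<in>{x. feasible N T s x}. nash_welfare N T v x)"

definition nash_maximizing ::
  "nat \<Rightarrow> nat \<Rightarrow> (nat \<Rightarrow> real) \<Rightarrow> (nat \<Rightarrow> nat \<Rightarrow> real) \<Rightarrow> (nat \<Rightarrow> nat \<Rightarrow> real) \<Rightarrow> bool" where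
  "nash_maximizing N T s v x \<longleftrightarrow>
     feasible N T s x \<and> (\<forall>y. feasible N T s y \<longrightarrow> nash_welfare N T v y \<le> nash_welfare N T v x)"

definition impartial_allocation ::
  "nat \<Rightarrow> nat \<Rightarrow> (nat \<Rightarrow> nat \<Rightarrow> real) \<Rightarrow> real \<Rightarrow> (nat \<Rightarrow> nat \<Rightarrow> real) \<Rightarrow> bool" where
  "impartial_allocation N T v \<mu> x \<longleftrightarrow>
     (\<forall>i<N. \<forall>j<N. utility T v x i \<le> \<mu> * utility T v x j)"

definition impartial_instance ::
  "nat \<Rightarrow> nat \<Rightarrow> (nat \<Rightarrow> real) \<Rightarrow> (nat \<Rightarrow> nat \<Rightarrow> real) \<Rightarrow> real \<Rightarrow> bool" where
  "impartial_instance N T s v \<mu> \<longleftrightarrow>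
     (\<forall>x. nash_maximizing N T s v x \<longrightarrow> impartial_allocation N T v \<mu> x)"

(* If some agent has value 0 for all items, then every allocation has Nash welfare 0 and a
   smallest \<mu> does not exist; LEAST is then some unspecified real number.  In that
   case the optimal Nash welfare is 0. *)
definition impartiality_ratio ::
  "nat \<Rightarrow> nat \<Rightarrow> (nat \<Rightarrow> real) \<Rightarrow> (nat \<Rightarrow> nat \<Rightarrow> real) \<Rightarrow> real" where
  "impartiality_ratio N T s v = (LEAST \<mu>. impartial_instance N T s v \<mu>)"

(* The base utilities u'_{it} at the arrival of item t, given the greedily allocated parts z
   of the earlier items. *)
definition base_utility ::
  "nat \<Rightarrow> (nat \<Rightarrow> real) \<Rightarrow> (nat \<Rightarrow> nat \<Rightarrow> real) \<Rightarrow> real \<Rightarrow> (nat \<Rightarrow> nat \<Rightarrow> real) \<Rightarrow>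
     nat \<Rightarrow> nat \<Rightarrow> real" where
  "base_utility N s v lam z i t =
     1 / (2 * lam * (real N)\<^sup>2) * (\<Sum>j<N. \<Sum>t'\<le>t. v j t' * s t') + (\<Sum>t'<t. v i t' * z i t')"

(* w distributes at most half of the item t among the agents. *)
definition half_split :: "nat \<Rightarrow> (nat \<Rightarrow> real) \<Rightarrow> nat \<Rightarrow> (nat \<Rightarrow> real) \<Rightarrow> bool" where
  "half_split N s t w \<longleftrightarrow> (\<forall>i<N. w i \<ge> 0) \<and> (\<Sum>i<N. w i) \<le> s t / 2"

(* The base utilities at t are either all positive, or all 0; in the latter case all values
   up to and including t are 0 and every half-split counts as a maximizer, since ln 0 = 0. *)
definition greedy_step ::
  "nat \<Rightarrow> (nat \<Rightarrow> real) \<Rightarrow> (nat \<Rightarrow> nat \<Rightarrow> real) \<Rightarrow> real \<Rightarrow> (nat \<Rightarrow> nat \<Rightarrow> real) \<Rightarrow> nat \<Rightarrow> bool" where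
  "greedy_step N s v lam z t \<longleftrightarrow>
     half_split N s t (\<lambda>i. z i t) \<and>
     (\<forall>w. half_split N s t w \<longrightarrow>
        (\<Sum>i<N. ln (base_utility N s v lam z i t + v i t * w i))
          \<le> (\<Sum>i<N. ln (base_utility N s v lam z i t + v i t * z i t)))"

(* x is a possible outcome of Half-and-Half with parameter lam; a maximizer need not be unique
   (only for items without value to any agent), and no tie-breaking rule is prescribed.
   The condition on item t refers only to items up to t. *)
definition half_and_half ::
  "nat \<Rightarrow> nat \<Rightarrow> (nat \<Rightarrow> real) \<Rightarrow> (nat \<Rightarrow> nat \<Rightarrow> real) \<Rightarrow> real \<Rightarrow> (nat \<Rightarrow> nat \<Rightarrow> real) \<Rightarrow> bool" where
  "half_and_half N T s v lam x \<longleftrightarrow>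
     (\<exists>z. (\<forall>t<T. greedy_step N s v lam z t) \<and>
          (\<forall>i<N. \<forall>t<T. x i t = s t / (2 * real N) + z i t))"

definition level_pmf :: "nat pmf" where
  "level_pmf = embed_pmf (\<lambda>k. 6 / pi\<^sup>2 * (1 / (real k + 1)\<^sup>2))"

lemma pmf_level_pmf: "pmf level_pmf k = 6 / pi\<^sup>2 * (1 / (real k + 1)\<^sup>2)"
  unfolding level_pmf_def
proof (rule pmf_embed_pmf)
  have s: "(\<lambda>k. 6 / pi\<^sup>2 * (1 / (real k + 1)\<^sup>2)) sums 1"
    using sums_mult[OF inverse_squares_sums, of "6 / pi\<^sup>2"] by (simp add: add.commute)
  have "(\<integral>\<^sup>+k. ennreal (6 / pi\<^sup>2 * (1 / (real k + 1)\<^sup>2)) \<partial>count_space UNIV)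
      = (\<Sum>k. ennreal (6 / pi\<^sup>2 * (1 / (real k + 1)\<^sup>2)))"
    by (rule nn_integral_count_space_nat)
  also have "\<dots> = ennreal (\<Sum>k. 6 / pi\<^sup>2 * (1 / (real k + 1)\<^sup>2))"
    using s by (intro suminf_ennreal2) (auto simp: sums_iff)
  also have "\<dots> = 1"
    using s by (simp add: sums_iff)
  finally show "(\<integral>\<^sup>+k. ennreal (6 / pi\<^sup>2 * (1 / (real k + 1)\<^sup>2)) \<partial>count_space UNIV) = 1" .
qed simp

(* p is a possible distribution of the allocation when k is sampled once, up front. *)
definition randomized_half_and_half ::
  "nat \<Rightarrow> nat \<Rightarrow> (nat \<Rightarrow> real) \<Rightarrow> (nat \<Rightarrow> nat \<Rightarrow> real) \<Rightarrow> (nat \<Rightarrow> nat \<Rightarrow> real) pmf \<Rightarrow> bool" where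
  "randomized_half_and_half N T s v p \<longleftrightarrow>
     (\<exists>X. (\<forall>k. half_and_half N T s v (2 ^ (2 ^ k)) (X k)) \<and> p = map_pmf X level_pmf)"

(* A randomized algorithm is given by the output distributions it may have on an instance; more
   than one is possible if ties are left open.  The ratio \<Gamma> may depend on the
   instance. *)
definition competitive ::
  "(nat \<Rightarrow> nat \<Rightarrow> (nat \<Rightarrow> real) \<Rightarrow> (nat \<Rightarrow> nat \<Rightarrow> real) \<Rightarrow> (nat \<Rightarrow> nat \<Rightarrow> real) pmf \<Rightarrow> bool) \<Rightarrow>
   (nat \<Rightarrow> nat \<Rightarrow> (nat \<Rightarrow> real) \<Rightarrow> (nat \<Rightarrow> nat \<Rightarrow> real) \<Rightarrow> real) \<Rightarrow> bool" where
  "competitive A \<Gamma> \<longleftrightarrow>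
     (\<forall>N T s v p. nw_instance N T s v \<longrightarrow> A N T s v p \<longrightarrow>
        opt_nash_welfare N T s v
          \<le> \<Gamma> N T s v * measure_pmf.expectation p (nash_welfare N T v))"

lemma greedy_step_cong:
  assumes "\<And>i t'. t' \<le> t \<Longrightarrow> z i t' = z' i t'"
  shows "greedy_step N s v lam z t \<longleftrightarrow> greedy_step N s v lam z' t"
proof -
  have "base_utility N s v lam z i t = base_utility N s v lam z' i t" for i
    using assms by (simp add: base_utility_def)
  then show ?thesis
    using assms by (simp add: greedy_step_def)
qed

lemma greedy_step_exists:
  assumes inst: "nw_instance N T s v" and lam: "lam > 0" and t: "t < T"
    and z: "\<And>i t'. i < N \<Longrightarrow> t' < t \<Longrightarrow> z i t' \<ge> 0"
  shows "\<exists>w. greedy_step N s v lam (\<lambda>i. (z i)(t := w i)) t"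
proof -
  define B where "B i = base_utility N s v lam z i t" for i
  define f where "f w = (\<Sum>i<N. ln (B i + v i t * w i))" for w :: "nat \<Rightarrow> real"
  have pos: "N \<ge> 1" "\<And>t'. t' \<le> t \<Longrightarrow> s t' > 0" "\<And>i t'. i < N \<Longrightarrow> t' \<le> t \<Longrightarrow> v i t' \<ge> 0"
    using inst t by (auto simp: nw_instance_def)
  define V where "V = (\<Sum>j<N. \<Sum>t'\<le>t. v j t' * s t')"
  have V0: "V \<ge> 0"
    unfolding V_def using pos by (intro sum_nonneg mult_nonneg_nonneg) (auto intro: less_imp_le)
  have B: "B i \<ge> V / (2 * lam * (real N)\<^sup>2)" if "i < N" for i
    unfolding B_def base_utility_def V_def
    using pos z that by (auto intro!: sum_nonneg mult_nonneg_nonneg)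
  have "\<exists>w. half_split N s t w \<and> (\<forall>y. half_split N s t y \<longrightarrow> f y \<le> f w)"
  proof (cases "V = 0")
    case True
    have v0: "v i t = 0" if "i < N" for i
    proof -
      have "(\<Sum>t'\<le>t. v i t' * s t') = 0"
        using True that pos unfolding V_def
        by (subst (asm) sum_nonneg_eq_0_iff)
           (auto intro!: sum_nonneg mult_nonneg_nonneg intro: less_imp_le)
      then have "v i t * s t = 0"
        using that pos by (subst (asm) sum_nonneg_eq_0_iff)
           (auto intro!: mult_nonneg_nonneg intro: less_imp_le)
      then show ?thesis using pos(2)[of t] by simp
    qed
    have "half_split N s t (\<lambda>_. 0)"
      using pos(2)[of t] by (simp add: half_split_def)
    moreover have "f y = f w" for y w
      by (simp add: f_def v0)
    ultimately show ?thesis by (metis order_refl)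
  next
    case False
    have Bpos: "B i > 0" if "i < N" for i
    proof -
      have "V / (2 * lam * (real N)\<^sup>2) > 0"
        using False V0 lam pos(1) by (intro divide_pos_pos) auto
      with B[OF that] show ?thesis by linarith
    qed
    define S where "S i = (if i < N then {0..s t / 2} else {0::real})" for i
    define K where "K = Pi\<^sub>E UNIV S \<inter> {w. (\<Sum>i<N. w i) \<le> s t / 2}"
    have "compactin (product_topology (\<lambda>_. euclidean) UNIV) (Pi\<^sub>E UNIV S)"
      by (subst compactin_PiE) (auto simp: S_def compactin_euclidean_iff)
    then have "compact (Pi\<^sub>E UNIV S)"
      by (simp add: euclidean_product_topology compactin_euclidean_iff)
    moreover have "closed {w :: nat \<Rightarrow> real. (\<Sum>i<N. w i) \<le> s t / 2}"
      by (intro closed_Collect_le continuous_on_sum continuous_on_const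
            continuous_on_product_coordinates)
    ultimately have "compact K"
      unfolding K_def by (rule compact_Int_closed)
    moreover have "(\<lambda>_. 0) \<in> K"
      using pos(2)[of t] by (auto simp: K_def S_def PiE_def Pi_def)
    moreover have "continuous_on K f"
      unfolding f_def
    proof (intro continuous_on_sum continuous_on_ln continuous_on_add continuous_on_mult
        continuous_on_const continuous_on_subset[OF continuous_on_product_coordinates] ballI)
      fix i w assume "i \<in> {..<N}" "w \<in> K"
      then have "i < N" "w i \<ge> 0"
        by (auto simp: K_def S_def PiE_def Pi_def dest!: spec[of _ i])
      then show "B i + v i t * w i \<noteq> 0"
        using Bpos[of i] pos(3)[of i t] mult_nonneg_nonneg[of "v i t" "w i"] by fastforce
    qed auto
    ultimately obtain w where w: "w \<in> K" "\<And>y. y \<in> K \<Longrightarrow> f y \<le> f w"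
      using continuous_attains_sup[of K f] by blast
    have "half_split N s t w"
      using w(1) by (auto simp: half_split_def K_def S_def PiE_def Pi_def split: if_splits)
    moreover have "f y \<le> f w" if y: "half_split N s t y" for y
    proof -
      define y' where "y' i = (if i < N then y i else 0)" for i
      have "y i \<le> s t / 2" if "i < N" for i
        using y member_le_sum[of i "{..<N}" y] that by (force simp: half_split_def)
      moreover have "(\<Sum>i<N. y' i) = (\<Sum>i<N. y i)"
        by (simp add: y'_def)
      ultimately have "y' \<in> K"
        using y by (auto simp: y'_def K_def S_def PiE_def Pi_def half_split_def)
      moreover have "f y' = f y"
        by (simp add: f_def y'_def)
      ultimately show ?thesis using w(2) by metis
    qed
    ultimately show ?thesis by blast
  qed
  then obtain w where w: "half_split N s t w" "\<And>y. half_split N s t y \<Longrightarrow> f y \<le> f w"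
    by blast
  have "base_utility N s v lam (\<lambda>i. (z i)(t := w i)) i t = B i" for i
    by (simp add: B_def base_utility_def)
  with w have "greedy_step N s v lam (\<lambda>i. (z i)(t := w i)) t"
    by (simp add: greedy_step_def f_def)
  then show ?thesis by blast
qed

lemma half_and_half_exists:
  assumes inst: "nw_instance N T s v" and lam: "lam > 0"
  shows "\<exists>x. half_and_half N T s v lam x"
proof -
  have "\<exists>z. \<forall>t<n. greedy_step N s v lam z t" if "n \<le> T" for n
    using that
  proof (induction n)
    case (Suc n)
    then obtain z where z: "\<forall>t<n. greedy_step N s v lam z t" by auto
    then have "z i t \<ge> 0" if "i < N" "t < n" for i t
      using that by (auto simp: greedy_step_def half_split_def)
    then obtain w where w: "greedy_step N s v lam (\<lambda>i. (z i)(n := w i)) n"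
      using greedy_step_exists[OF inst lam, of n z] Suc.prems by auto
    moreover have "greedy_step N s v lam (\<lambda>i. (z i)(n := w i)) t" if "t < n" for t
      using z that greedy_step_cong[of t "\<lambda>i. (z i)(n := w i)" z] by auto
    ultimately show ?case by (auto simp: less_Suc_eq)
  qed simp
  then obtain z where z: "\<forall>t<T. greedy_step N s v lam z t" by blast
  then have "half_and_half N T s v lam (\<lambda>i t. s t / (2 * real N) + z i t)"
    unfolding half_and_half_def by blast
  then show ?thesis by blast
qed

lemma randomized_half_and_half_exists:
  assumes "nw_instance N T s v"
  shows "\<exists>p. randomized_half_and_half N T s v p"
proof -
  have "\<exists>X. \<forall>k. half_and_half N T s v (2 ^ (2 ^ k)) (X k)"
    by (intro choice allI half_and_half_exists[OF assms]) simp
  then show ?thesis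
    unfolding randomized_half_and_half_def by blast
qed

end

theory Submission
  imports Defs
begin

text \<open>Let \<open>u\<close> be the utilities of an optimal allocation, \<open>V\<close> the total value of all agents for all
  items, and \<open>c = 1 / (2 \<lambda> N\<^sup>2)\<close>.  Optimality gives proportionality, so impartiality yields
  \<open>u\<^sub>i \<ge> V / (\<mu> N\<^sup>2)\<close>.  Hence the items arriving while the value seen so far is at most
  \<open>c V\<close> contribute at most \<open>u\<^sub>i / 2\<close> to each \<open>u\<^sub>i\<close>.  On the later items the first-order condition of the
  greedy step bounds \<open>\<Sum>\<^sub>i u\<^sub>i / a\<^sub>i\<close>, where \<open>a\<^sub>i\<close> is the final regularized greedy utility, by the relative
  increments of the greedy utilities, whose sum telescopes to \<open>O(N log (\<lambda> N))\<close>; AM-GM turns this into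
  a bound on the ratio of Nash welfares.  As soon as \<open>\<lambda> \<ge> \<mu> N\<close>, the regularization \<open>c V\<close> is covered by
  the equally split halves.  The first level \<open>k\<close> with \<open>2^(2^k) \<ge> \<mu> N\<close> satisfies \<open>log \<lambda> = O(log (\<mu> N))\<close> and is
  sampled with probability of order \<open>1 / (log log (\<mu> N))\<^sup>2\<close>.\<close>

section \<open>Total values and first-order conditions for logarithmic objectives\<close>

definition total_value :: "nat \<Rightarrow> (nat \<Rightarrow> real) \<Rightarrow> (nat \<Rightarrow> nat \<Rightarrow> real) \<Rightarrow> nat \<Rightarrow> real" where
  "total_value n s v i = (\<Sum>t<n. v i t * s t)"

text \<open>The sum on the left is the derivative at \<open>e = 0\<close> of the objective along
  direction \<open>d\<close>. Were it positive, a small step \<open>e\<close> would beat the assumed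
  maximum.\<close>

lemma sum_ln_first_order:
  fixes a d :: "'a \<Rightarrow> real"
  assumes fin: "finite I" and pos: "\<And>i. i \<in> I \<Longrightarrow> a i > 0"
    and max: "\<And>e. 0 < e \<Longrightarrow> e < 1 \<Longrightarrow> (\<Sum>i\<in>I. ln (a i + e * d i)) \<le> (\<Sum>i\<in>I. ln (a i))"
  shows "(\<Sum>i\<in>I. d i / a i) \<le> 0"
proof (rule ccontr)
  assume "\<not> ?thesis"
  then have p: "(\<Sum>i\<in>I. d i / a i) > 0" by simp
  have "((\<lambda>e. \<Sum>i\<in>I. ln (a i + e * d i)) has_real_derivative (\<Sum>i\<in>I. d i / a i)) (at 0)"
    by (rule DERIV_sum) (auto intro!: derivative_eq_intros simp: pos field_simps)
  from DERIV_pos_inc_right[OF this p] obtain \<delta> where \<delta>: "\<delta> > 0"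
    and inc: "\<And>h. h > 0 \<Longrightarrow> h < \<delta> \<Longrightarrow> (\<Sum>i\<in>I. ln (a i)) < (\<Sum>i\<in>I. ln (a i + h * d i))"
    by auto
  define h where "h = min (\<delta> / 2) (1 / 2)"
  have "0 < h" "h < \<delta>" "h < 1" using \<delta> by (auto simp: h_def)
  with inc[of h] max[of h] show False by linarith
qed

text \<open>Half-splits form a convex set, so moving from the greedy split towards \<open>w\<close>
  stays admissible, and the derivative along this segment cannot be positive.\<close>

lemma greedy_step_first_order:
  assumes g: "greedy_step N s v lam z t" and w: "half_split N s t w"
    and pos: "\<And>i. i < N \<Longrightarrow> base_utility N s v lam z i t > 0"
    and v: "\<And>i. i < N \<Longrightarrow> v i t \<ge> 0"
  shows "(\<Sum>i<N. v i t * w i / (base_utility N s v lam z i t + v i t * z i t))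
    \<le> (\<Sum>i<N. v i t * z i t / (base_utility N s v lam z i t + v i t * z i t))"
proof -
  define a where "a i = base_utility N s v lam z i t + v i t * z i t" for i
  define d where "d i = v i t * (w i - z i t)" for i
  have hz: "half_split N s t (\<lambda>i. z i t)" using g by (simp add: greedy_step_def)
  have a: "a i > 0" if "i < N" for i
    using pos[OF that] v[OF that] hz that unfolding a_def half_split_def
    by (intro add_pos_nonneg mult_nonneg_nonneg) auto
  have "(\<Sum>i<N. d i / a i) \<le> 0"
  proof (rule sum_ln_first_order)
    fix e :: real assume e: "0 < e" "e < 1"
    define y where "y i = (1 - e) * z i t + e * w i" for i
    have "(\<Sum>i<N. y i) = (1 - e) * (\<Sum>i<N. z i t) + e * (\<Sum>i<N. w i)"
      by (simp add: y_def sum.distrib sum_distrib_left)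
    also have "\<dots> \<le> (1 - e) * (s t / 2) + e * (s t / 2)"
      using e hz w by (intro add_mono mult_left_mono) (auto simp: half_split_def)
    also have "\<dots> = s t / 2" by (simp add: field_simps)
    finally have "half_split N s t y"
      using e hz w by (auto simp: half_split_def y_def intro!: add_nonneg_nonneg)
    with g have "(\<Sum>i<N. ln (base_utility N s v lam z i t + v i t * y i)) \<le> (\<Sum>i<N. ln (a i))"
      by (simp add: greedy_step_def a_def)
    moreover have "base_utility N s v lam z i t + v i t * y i = a i + e * d i" for i
      by (simp add: a_def d_def y_def algebra_simps)
    ultimately show "(\<Sum>i<N. ln (a i + e * d i)) \<le> (\<Sum>i<N. ln (a i))" by simp
  qed (use a in auto)
  then show ?thesis
    by (simp add: d_def a_def right_diff_distrib diff_divide_distrib sum_subtractf)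
qed

section \<open>Optimal allocations and the impartiality ratio\<close>

lemma utility_nonneg:
  assumes "nw_instance N T s v" "feasible N T s x" "i < N"
  shows "utility T v x i \<ge> 0"
  using assms by (auto simp: nw_instance_def feasible_def utility_def intro!: sum_nonneg)

lemma utility_le_total_value:
  assumes inst: "nw_instance N T s v" and x: "feasible N T s x" and i: "i < N"
  shows "utility T v x i \<le> total_value T s v i"
  unfolding utility_def total_value_def
proof (rule sum_mono)
  fix t assume t: "t \<in> {..<T}"
  have "x i t \<le> (\<Sum>j<N. x j t)"
    by (rule member_le_sum) (use x i t in \<open>auto simp: feasible_def\<close>)
  also have "\<dots> \<le> s t" using x t by (auto simp: feasible_def)
  finally have "x i t * v i t \<le> s t * v i t"
    by (rule mult_right_mono) (use inst i t in \<open>auto simp: nw_instance_def\<close>)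
  then show "x i t * v i t \<le> v i t * s t" by (simp add: mult.commute)
qed

lemma nash_welfare_nonneg:
  assumes "nw_instance N T s v" "feasible N T s x"
  shows "nash_welfare N T v x \<ge> 0"
  unfolding nash_welfare_def using utility_nonneg[OF assms]
  by (auto intro!: real_root_ge_zero prod_nonneg)

text \<open>The bound does not depend on \<open>x\<close>; it makes the Nash welfare integrable over
  the infinitely many levels of the randomized algorithm.\<close>

lemma nash_welfare_bound:
  assumes inst: "nw_instance N T s v" and x: "feasible N T s x"
  shows "nash_welfare N T v x \<le> root N (\<Prod>i<N. total_value T s v i)"
  unfolding nash_welfare_def
  using inst utility_nonneg[OF assms] utility_le_total_value[OF assms]
  by (intro real_root_le_mono prod_mono) (auto simp: nw_instance_def)

text \<open>The segment from \<open>x\<close> to \<open>y\<close> is feasible, and since its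
  utilities stay positive for \<open>e < 1\<close>, maximality of the product passes to the sum of
  logarithms.\<close>

lemma nash_maximizing_first_order:
  assumes inst: "nw_instance N T s v" and x: "nash_maximizing N T s v x"
    and pos: "\<And>i. i < N \<Longrightarrow> utility T v x i > 0" and y: "feasible N T s y"
  shows "(\<Sum>i<N. utility T v y i / utility T v x i) \<le> real N"
proof -
  define d where "d i = utility T v y i - utility T v x i" for i
  have fx: "feasible N T s x" using x by (simp add: nash_maximizing_def)
  have "(\<Sum>i<N. d i / utility T v x i) \<le> 0"
  proof (rule sum_ln_first_order)
    fix e :: real assume e: "0 < e" "e < 1"
    define w where "w i t = (1 - e) * x i t + e * y i t" for i t
    have "(\<Sum>i<N. w i t) \<le> s t" if "t < T" for t
    proof -
      have "(\<Sum>i<N. w i t) = (1 - e) * (\<Sum>i<N. x i t) + e * (\<Sum>i<N. y i t)"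
        by (simp add: w_def sum.distrib sum_distrib_left)
      also have "\<dots> \<le> (1 - e) * s t + e * s t"
        using e fx y that by (intro add_mono mult_left_mono) (auto simp: feasible_def)
      finally show ?thesis by (simp add: algebra_simps)
    qed
    then have w: "feasible N T s w"
      using e fx y by (auto simp: feasible_def w_def intro!: add_nonneg_nonneg)
    have u: "utility T v w i = utility T v x i + e * d i" for i
      by (simp add: utility_def w_def d_def sum.distrib sum_distrib_left sum_subtractf algebra_simps)
    have upos: "utility T v x i + e * d i > 0" if "i < N" for i
    proof -
      have "utility T v x i + e * d i = (1 - e) * utility T v x i + e * utility T v y i"
        by (simp add: d_def algebra_simps)
      then show ?thesis
        using pos[OF that] utility_nonneg[OF inst y that] e by (simp add: add_pos_nonneg)
    qed
    have "(\<Prod>i<N. utility T v w i) \<le> (\<Prod>i<N. utility T v x i)"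
      using x w inst by (auto simp: nash_maximizing_def nash_welfare_def nw_instance_def)
    then have "ln (\<Prod>i<N. utility T v x i + e * d i) \<le> ln (\<Prod>i<N. utility T v x i)"
      using upos pos by (subst ln_le_cancel_iff) (auto simp: u intro!: prod_pos)
    then show "(\<Sum>i<N. ln (utility T v x i + e * d i)) \<le> (\<Sum>i<N. ln (utility T v x i))"
      using upos pos by (subst (asm) (1 2) ln_prod) (auto simp: less_imp_neq[symmetric])
  qed (use pos in auto)
  also have "(\<Sum>i<N. d i / utility T v x i) = (\<Sum>i<N. utility T v y i / utility T v x i - 1)"
    by (rule sum.cong) (use pos in \<open>auto simp: d_def diff_divide_distrib less_imp_neq[symmetric]\<close>)
  finally show ?thesis by (simp add: sum_subtractf)
qed

text \<open>Compare with the allocation giving every item to agent \<open>i\<close>: all other terms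
  of the first-order sum vanish, so the term of \<open>i\<close> alone is at most
  \<open>N\<close>.\<close>

lemma nash_maximizing_proportional:
  assumes inst: "nw_instance N T s v" and x: "nash_maximizing N T s v x"
    and pos: "\<And>i. i < N \<Longrightarrow> utility T v x i > 0" and i: "i < N"
  shows "total_value T s v i \<le> real N * utility T v x i"
proof -
  define y where "y j t = (if j = i then s t else 0)" for j t
  have y: "feasible N T s y"
    using inst i by (auto simp: feasible_def y_def nw_instance_def less_imp_le)
  have "utility T v y i / utility T v x i \<le> (\<Sum>j<N. utility T v y j / utility T v x j)"
    by (rule member_le_sum)
       (use i pos utility_nonneg[OF inst y] in \<open>auto intro!: divide_nonneg_pos\<close>)
  also have "\<dots> \<le> real N" by (rule nash_maximizing_first_order[OF inst x pos y])
  finally have "utility T v y i \<le> real N * utility T v x i"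
    using pos[OF i] by (simp add: pos_divide_le_eq)
  then show ?thesis by (simp add: y_def utility_def total_value_def mult.commute)
qed

text \<open>The equal split has positive Nash welfare, so a maximizer cannot leave any agent with
  utility 0.\<close>

lemma nash_maximizing_utility_pos:
  assumes inst: "nw_instance N T s v" and x: "nash_maximizing N T s v x"
    and pos: "\<And>i. i < N \<Longrightarrow> total_value T s v i > 0" and i: "i < N"
  shows "utility T v x i > 0"
proof -
  have N: "N > 0" using inst by (simp add: nw_instance_def)
  have fx: "feasible N T s x" using x by (simp add: nash_maximizing_def)
  define y where "y j t = s t / real N" for j t :: nat
  have y: "feasible N T s y"
    using inst by (auto simp: feasible_def y_def nw_instance_def less_imp_le)
  have "utility T v y j = total_value T s v j / real N" for j
    by (simp add: y_def utility_def total_value_def sum_divide_distrib mult.commute)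
  then have "nash_welfare N T v y > 0"
    using N pos by (auto simp: nash_welfare_def intro!: prod_pos)
  also have "nash_welfare N T v y \<le> nash_welfare N T v x"
    using x y by (auto simp: nash_maximizing_def)
  finally have "(\<Prod>i<N. utility T v x i) > 0"
    using N by (simp add: nash_welfare_def)
  then have "utility T v x i \<noteq> 0"
    using i prod_zero[of "{..<N}" "utility T v x"] by (metis finite_lessThan lessThan_iff less_irrefl)
  with utility_nonneg[OF inst fx i] show ?thesis by simp
qed

lemma nash_maximizing_exists:
  assumes inst: "nw_instance N T s v"
  shows "\<exists>x. nash_maximizing N T s v x"
proof -
  \<comment> \<open>Entries outside the index ranges are pinned to 0. This makes the product of the
    ranges compact and does not change the Nash welfare.\<close>
  define S where "S t = (if t < T then {0..s t} else {0::real})" for t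
  define R where "R i = (if i < N then Pi\<^sub>E UNIV S else {\<lambda>_::nat. 0::real})" for i :: nat
  define K where "K = Pi\<^sub>E UNIV R \<inter> (\<Inter>t\<in>{..<T}. {x. (\<Sum>i<N. x i t) \<le> s t})"
  have cont: "continuous_on UNIV (\<lambda>x :: nat \<Rightarrow> nat \<Rightarrow> real. x i t)" for i t
    by (rule continuous_on_product_then_coordinatewise[OF continuous_on_product_coordinates])
  have "compactin (product_topology (\<lambda>_. euclidean) UNIV) (Pi\<^sub>E UNIV S)"
    by (subst compactin_PiE) (auto simp: S_def compactin_euclidean_iff)
  then have "compact (Pi\<^sub>E UNIV S)"
    by (simp add: euclidean_product_topology compactin_euclidean_iff)
  then have "compactin (product_topology (\<lambda>_. euclidean) UNIV) (Pi\<^sub>E UNIV R)"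
    by (subst compactin_PiE) (auto simp: R_def compactin_euclidean_iff)
  then have "compact (Pi\<^sub>E UNIV R)"
    by (simp add: euclidean_product_topology compactin_euclidean_iff)
  moreover have "closed (\<Inter>t\<in>{..<T}. {x :: nat \<Rightarrow> nat \<Rightarrow> real. (\<Sum>i<N. x i t) \<le> s t})"
    by (intro closed_INT ballI closed_Collect_le continuous_on_sum continuous_on_const cont)
  ultimately have "compact K"
    unfolding K_def by (rule compact_Int_closed)
  moreover have "(\<lambda>_ _. 0) \<in> K"
    using inst by (auto simp: K_def R_def S_def PiE_def Pi_def nw_instance_def less_imp_le)
  moreover have "continuous_on UNIV (nash_welfare N T v)"
    unfolding nash_welfare_def utility_def
    by (intro continuous_on_real_root continuous_on_prod continuous_on_sum continuous_on_mult
        continuous_on_const cont)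
  then have "continuous_on K (nash_welfare N T v)"
    by (rule continuous_on_subset) simp
  ultimately obtain x where x: "x \<in> K" "\<And>y. y \<in> K \<Longrightarrow> nash_welfare N T v y \<le> nash_welfare N T v x"
    using continuous_attains_sup[of K "nash_welfare N T v"] by blast
  have "feasible N T s x"
    using x(1) by (auto simp: K_def R_def S_def PiE_def Pi_def feasible_def split: if_splits)
  moreover have "nash_welfare N T v y \<le> nash_welfare N T v x" if y: "feasible N T s y" for y
  proof -
    define y' where "y' i t = (if i < N \<and> t < T then y i t else 0)" for i t
    have "y i t \<le> s t" if "i < N" "t < T" for i t
      using y member_le_sum[of i "{..<N}" "\<lambda>i. y i t"] that by (force simp: feasible_def)
    then have "y' \<in> K"
      using y by (auto simp: y'_def K_def R_def S_def PiE_def Pi_def feasible_def)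
    moreover have "nash_welfare N T v y' = nash_welfare N T v y"
      by (simp add: nash_welfare_def utility_def y'_def)
    ultimately show ?thesis using x(2) by metis
  qed
  ultimately show ?thesis unfolding nash_maximizing_def by blast
qed

lemma opt_nash_welfare_eq:
  assumes "nash_maximizing N T s v x"
  shows "opt_nash_welfare N T s v = nash_welfare N T v x"
  unfolding opt_nash_welfare_def
  by (rule cSup_eq_maximum) (use assms in \<open>auto simp: nash_maximizing_def\<close>)

text \<open>A \<open>LEAST\<close> over the reals says something only if the minimum is attained.
  With positive utilities each constraint bounds a ratio \<open>u i / u j\<close> by
  \<open>\<mu>\<close>, and such bounds pass to the infimum.\<close>

lemma impartiality_ratio:
  assumes inst: "nw_instance N T s v" and pos: "\<And>i. i < N \<Longrightarrow> total_value T s v i > 0"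
  shows "impartial_instance N T s v (impartiality_ratio N T s v)" "impartiality_ratio N T s v \<ge> 1"
proof -
  define A where "A = {\<mu>. impartial_instance N T s v \<mu>}"
  have N: "N > 0" using inst by (simp add: nw_instance_def)
  obtain x where x: "nash_maximizing N T s v x" using nash_maximizing_exists[OF inst] by blast
  have upos: "utility T v y i > 0" if "nash_maximizing N T s v y" "i < N" for y i
    by (rule nash_maximizing_utility_pos[OF inst that(1) pos that(2)])
  have ge1: "\<mu> \<ge> 1" if "\<mu> \<in> A" for \<mu>
  proof -
    have "utility T v x 0 \<le> \<mu> * utility T v x 0"
      using that x N by (auto simp: A_def impartial_instance_def impartial_allocation_def)
    then show ?thesis using upos[OF x N] by simp
  qed
  then have bdd: "bdd_below A" by (rule bdd_belowI)
  \<comment> \<open>An explicit admissible \<open>\<mu>\<close>: a utility is at most the total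
    value and, by proportionality, at least its \<open>N\<close>-th part. Summing the resulting
    bounds over all pairs dominates each of them.\<close>
  define m where "m = (\<Sum>i<N. \<Sum>j<N. total_value T s v i * real N / total_value T s v j)"
  have "m \<in> A"
    unfolding A_def impartial_instance_def impartial_allocation_def mem_Collect_eq
  proof (intro allI impI)
    fix y i j assume y: "nash_maximizing N T s v y" and ij: "i < N" "j < N"
    have fy: "feasible N T s y" using y by (simp add: nash_maximizing_def)
    have "total_value T s v i * real N / total_value T s v j
        \<le> (\<Sum>j<N. total_value T s v i * real N / total_value T s v j)"
      by (rule member_le_sum) (use ij pos in \<open>auto intro!: divide_nonneg_pos simp: less_imp_le\<close>)
    also have "\<dots> \<le> m"
      unfolding m_def by (rule member_le_sum)
        (use ij pos in \<open>auto intro!: sum_nonneg divide_nonneg_pos simp: less_imp_le\<close>)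
    finally have m: "total_value T s v i * real N / total_value T s v j \<le> m" .
    have "utility T v y i \<le> total_value T s v i"
      by (rule utility_le_total_value[OF inst fy ij(1)])
    also have "\<dots> = total_value T s v i * real N / total_value T s v j * (total_value T s v j / real N)"
      using pos[OF ij(2)] N by simp
    also have "\<dots> \<le> m * utility T v y j"
    proof (intro mult_mono m)
      show "total_value T s v j / real N \<le> utility T v y j"
        using nash_maximizing_proportional[OF inst y upos[OF y] ij(2)] N
        by (simp add: pos_divide_le_eq mult.commute)
      show "0 \<le> m" using m pos[OF ij(1)] pos[OF ij(2)] by (smt (verit) divide_nonneg_pos mult_nonneg_nonneg of_nat_0_le_iff)
    qed (use pos ij in \<open>auto intro: less_imp_le\<close>)
    finally show "utility T v y i \<le> m * utility T v y j" .
  qed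
  then have ne: "A \<noteq> {}" by blast
  have inA: "impartial_instance N T s v (Inf A)"
    unfolding impartial_instance_def impartial_allocation_def
  proof (intro allI impI)
    fix y i j assume y: "nash_maximizing N T s v y" and ij: "i < N" "j < N"
    have "utility T v y i / utility T v y j \<le> Inf A"
      by (rule cInf_greatest[OF ne])
         (use y ij upos[OF y] in \<open>auto simp: A_def impartial_instance_def impartial_allocation_def pos_divide_le_eq\<close>)
    then show "utility T v y i \<le> Inf A * utility T v y j"
      using upos[OF y ij(2)] by (simp add: pos_divide_le_eq)
  qed
  have "impartiality_ratio N T s v = Inf A"
    unfolding impartiality_ratio_def
    by (rule Least_equality) (use inA bdd in \<open>auto simp: A_def intro: cInf_lower\<close>)
  with inA ge1 show "impartial_instance N T s v (impartiality_ratio N T s v)"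
    "impartiality_ratio N T s v \<ge> 1" by (auto simp: A_def)
qed

section \<open>Half-and-Half with a fixed parameter\<close>

text \<open>\<open>W\<close> is the regularization term.  It has no positive lower bound over all steps, so the logarithmic
  bound only holds for the steps at which it exceeds a threshold.\<close>
lemma sum_increment_ratio_le_ln:
  fixes W Z :: "nat \<Rightarrow> real"
  assumes th: "\<theta> > 0" and W: "mono W" and Z: "mono Z" and Z0: "Z 0 \<ge> 0"
  shows "(\<Sum>t | t < n \<and> W (Suc t) > \<theta>. (Z (Suc t) - Z t) / (W (Suc t) + Z (Suc t)))
    \<le> ln ((max (W n) \<theta> + Z n) / \<theta>)"
proof (induction n)
  case 0
  then show ?case using th Z0 by (simp add: divide_simps)
next
  case (Suc n)
  define f where "f t = (Z (Suc t) - Z t) / (W (Suc t) + Z (Suc t))" for t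
  have Zn: "Z n \<ge> 0" using Z0 monoD[OF Z, of 0 n] by simp
  have ZS: "Z n \<le> Z (Suc n)" "W n \<le> W (Suc n)" by (auto intro: monoD[OF Z] monoD[OF W])
  show ?case
  proof (cases "W (Suc n) > \<theta>")
    case True
    \<comment> \<open>\<open>a\<close> and \<open>b\<close> are the utilities before and after the
      increment, both with the new regularization. The increment costs \<open>1 - a / b\<close>, at
      most \<open>ln (b / a)\<close>, and raising the regularization only enlarges the previous
      bound to \<open>ln (a / \<theta>)\<close>.\<close>
    define a b where "a = W (Suc n) + Z n" and "b = W (Suc n) + Z (Suc n)"
    have ab: "a > 0" "b > 0" using True th Zn ZS by (auto simp: a_def b_def)
    have "{t. t < Suc n \<and> W (Suc t) > \<theta>} = insert n {t. t < n \<and> W (Suc t) > \<theta>}"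
      using True by (auto simp: less_Suc_eq)
    then have "(\<Sum>t | t < Suc n \<and> W (Suc t) > \<theta>. f t) = f n + (\<Sum>t | t < n \<and> W (Suc t) > \<theta>. f t)"
      by simp
    also have "f n = 1 - a / b"
      using ab by (simp add: f_def a_def b_def diff_divide_distrib[symmetric] field_simps)
    also have "\<dots> \<le> - ln (a / b)"
      using ln_le_minus_one[of "a / b"] ab by simp
    also have "\<dots> = ln (b / a)" using ab by (simp add: ln_div)
    also have "(\<Sum>t | t < n \<and> W (Suc t) > \<theta>. f t) \<le> ln ((max (W n) \<theta> + Z n) / \<theta>)"
      using Suc by (simp add: f_def)
    also have "\<dots> \<le> ln (a / \<theta>)"
    proof -
      have "max (W n) \<theta> + Z n \<le> a" using True ZS by (simp add: a_def)
      moreover have "max (W n) \<theta> + Z n > 0" using th Zn by (simp add: add_pos_nonneg max_def)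
      ultimately show ?thesis using th ab by (simp add: divide_right_mono)
    qed
    also have "ln (b / a) + ln (a / \<theta>) = ln ((max (W (Suc n)) \<theta> + Z (Suc n)) / \<theta>)"
      using ab th True by (simp add: ln_div b_def)
    finally show ?thesis by (simp add: f_def)
  next
    case False
    then have "{t. t < Suc n \<and> W (Suc t) > \<theta>} = {t. t < n \<and> W (Suc t) > \<theta>}"
      by (auto simp: less_Suc_eq)
    then have "(\<Sum>t | t < Suc n \<and> W (Suc t) > \<theta>. f t) \<le> ln ((max (W n) \<theta> + Z n) / \<theta>)"
      using Suc by (simp add: f_def)
    also have "\<dots> \<le> ln ((max (W (Suc n)) \<theta> + Z (Suc n)) / \<theta>)"
    proof -
      have "max (W n) \<theta> + Z n > 0" using th Zn by (simp add: add_pos_nonneg max_def)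
      moreover have "max (W n) \<theta> + Z n \<le> max (W (Suc n)) \<theta> + Z (Suc n)" using ZS by auto
      ultimately show ?thesis using th by (simp add: divide_right_mono)
    qed
    finally show ?thesis by (simp add: f_def)
  qed
qed

lemma half_and_half_feasible:
  assumes inst: "nw_instance N T s v" and x: "half_and_half N T s v lam x"
  shows "feasible N T s x"
proof -
  obtain z where g: "\<And>t. t < T \<Longrightarrow> greedy_step N s v lam z t"
    and xz: "\<And>i t. i < N \<Longrightarrow> t < T \<Longrightarrow> x i t = s t / (2 * real N) + z i t"
    using x by (auto simp: half_and_half_def)
  have z: "half_split N s t (\<lambda>i. z i t)" if "t < T" for t
    using g[OF that] by (simp add: greedy_step_def)
  have "(\<Sum>i<N. x i t) \<le> s t" if t: "t < T" for t
  proof -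
    have "(\<Sum>i<N. x i t) = (\<Sum>i<N. s t / (2 * real N)) + (\<Sum>i<N. z i t)"
      using xz t by (simp add: sum.distrib)
    also have "\<dots> \<le> s t / 2 + s t / 2"
      using z[OF t] inst by (intro add_mono) (auto simp: half_split_def nw_instance_def)
    finally show ?thesis by simp
  qed
  moreover have "x i t \<ge> 0" if "i < N" "t < T" for i t
    using xz[OF that] z[OF that(2)] that inst by (auto simp: half_split_def nw_instance_def less_imp_le)
  ultimately show ?thesis by (simp add: feasible_def)
qed

text \<open>The constant is \<open>36 = 2 * 2 * 9\<close>: one factor 2 for discarding early items,
  another because the greedy part has only half of each item, and 9 from
  \<open>D <= 9 * ln lam\<close>.\<close>

lemma half_and_half_nash_welfare:
  assumes inst: "nw_instance N T s v" and pos: "\<And>i. i < N \<Longrightarrow> total_value T s v i > 0"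
    and x: "nash_maximizing N T s v x" and imp: "impartial_instance N T s v \<mu>" and mu: "\<mu> \<ge> 1"
    and lam: "lam \<ge> 2" "lam \<ge> \<mu> * real N"
    and y: "half_and_half N T s v lam y"
  shows "nash_welfare N T v x \<le> 36 * ln lam * nash_welfare N T v y"
proof -
  obtain z where g: "\<And>t. t < T \<Longrightarrow> greedy_step N s v lam z t"
    and yz: "\<And>i t. i < N \<Longrightarrow> t < T \<Longrightarrow> y i t = s t / (2 * real N) + z i t"
    using y by (auto simp: half_and_half_def)
  have N: "N > 0" and s0: "\<And>t. t < T \<Longrightarrow> s t \<ge> 0" and v0: "\<And>i t. i < N \<Longrightarrow> t < T \<Longrightarrow> v i t \<ge> 0"
    using inst by (auto simp: nw_instance_def less_imp_le)
  have hz: "half_split N s t (\<lambda>i. z i t)" if "t < T" for t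
    using g[OF that] by (simp add: greedy_step_def)
  have z0: "z i t \<ge> 0" if "i < N" "t < T" for i t
    using hz[OF that(2)] that by (simp add: half_split_def)
  have zs: "z i t \<le> s t" if "i < N" "t < T" for i t
  proof -
    have "z i t \<le> (\<Sum>i<N. z i t)"
      by (rule member_le_sum) (use z0 that in auto)
    also have "\<dots> \<le> s t / 2" using hz[OF that(2)] by (simp add: half_split_def)
    finally show ?thesis using s0[OF that(2)] by simp
  qed
  have fx: "feasible N T s x" using x by (simp add: nash_maximizing_def)
  define c where "c = 1 / (2 * lam * (real N)\<^sup>2)"
  define V where "V n = (\<Sum>j<N. total_value n s v j)" for n
  define Z where "Z i n = (\<Sum>t<n. v i t * z i t)" for i n
  define u where "u i = utility T v x i" for i
  define a where "a i = c * V T + Z i T" for i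
  \<comment> \<open>Both indices are \<open>Suc t\<close>: the regularization already counts item
    \<open>t\<close> when it arrives, and the denominator of the first-order condition includes the
    greedy share of \<open>t\<close>.\<close>
  define U where "U i t = c * V (Suc t) + Z i (Suc t)" for i t
  have lam0: "lam > 0" using lam by simp
  have c0: "c > 0" using lam0 N by (simp add: c_def)
  have u0: "u i > 0" if "i < N" for i
    unfolding u_def by (rule nash_maximizing_utility_pos[OF inst x pos that])
  have VT: "V T > 0"
    unfolding V_def by (rule sum_pos) (use pos N in auto)
  have Vmono: "V n \<le> V m" if "n \<le> m" "m \<le> T" for n m
    unfolding V_def total_value_def
    by (intro sum_mono sum_mono2) (use that s0 v0 in auto)
  have Zmono: "Z i n \<le> Z i m" if "n \<le> m" "m \<le> T" "i < N" for n m i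
    unfolding Z_def by (intro sum_mono2) (use that z0 v0 in auto)
  have base: "base_utility N s v lam z i t = c * V (Suc t) + Z i t" for i t
    by (simp add: base_utility_def c_def V_def Z_def total_value_def lessThan_Suc_atMost)
  have baseU: "base_utility N s v lam z i t + v i t * z i t = U i t" for i t
    by (simp add: base U_def Z_def)
  have M: "total_value T s v i \<le> V T" if "i < N" for i
    unfolding V_def by (rule member_le_sum) (use that pos in \<open>auto intro: less_imp_le\<close>)
  have Vu: "V T \<le> (real N)\<^sup>2 * \<mu> * u i" if i: "i < N" for i
  proof -
    have "V T \<le> (\<Sum>j<N. real N * (\<mu> * u i))"
      unfolding V_def
    proof (rule sum_mono)
      fix j assume j: "j \<in> {..<N}"
      have "total_value T s v j \<le> real N * u j"
        using nash_maximizing_proportional[OF inst x nash_maximizing_utility_pos[OF inst x pos]] j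
        by (simp add: u_def)
      also have "\<dots> \<le> real N * (\<mu> * u i)"
        using imp x i j N by (auto simp: impartial_instance_def impartial_allocation_def u_def)
      finally show "total_value T s v j \<le> real N * (\<mu> * u i)" .
    qed
    then show ?thesis by (simp add: power2_eq_square mult.assoc)
  qed
  have Nmu: "real N \<le> \<mu> * real N" "\<mu> \<le> \<mu> * real N" using mu N by auto
  have cVu: "c * V T \<le> u i / 2" if "i < N" for i
  proof -
    have "(real N)\<^sup>2 * \<mu> * u i \<le> (real N)\<^sup>2 * lam * u i"
      using u0[OF that] Nmu lam by (intro mult_right_mono mult_left_mono) auto
    with Vu[OF that] have "V T \<le> (real N)\<^sup>2 * lam * u i" by linarith
    then show ?thesis using lam0 N by (simp add: c_def divide_simps mult.commute mult.left_commute)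
  qed
  \<comment> \<open>The equally split half gives agent \<open>i\<close> exactly this right-hand
    side. Here \<open>lam >= \<mu> * N\<close> enters with its factor \<open>N\<close>; the
    preceding bound only uses \<open>lam >= \<mu>\<close>.\<close>
  have cVM: "c * V T \<le> total_value T s v i / (2 * real N)" if "i < N" for i
  proof -
    have uM: "u i \<le> total_value T s v i"
      unfolding u_def by (rule utility_le_total_value[OF inst fx that])
    have "V T \<le> real N * (\<mu> * real N) * u i"
      using Vu[OF that] by (simp add: power2_eq_square mult.commute mult.left_commute)
    also have "\<dots> \<le> real N * lam * total_value T s v i"
      using uM u0[OF that] lam Nmu mu by (intro mult_mono mult_left_mono) auto
    finally show ?thesis using lam0 N
      by (simp add: c_def divide_simps power2_eq_square mult.commute mult.left_commute)
  qed
  have ua: "a i \<le> utility T v y i" if "i < N" for i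
  proof -
    have "utility T v y i = total_value T s v i / (2 * real N) + Z i T"
      using yz[OF that]
      by (simp add: utility_def total_value_def Z_def sum.distrib[symmetric] sum_divide_distrib algebra_simps)
    then show ?thesis using cVM[OF that] by (simp add: a_def)
  qed
  have Z0: "Z i n \<ge> 0" if "i < N" "n \<le> T" for i n
    using Zmono[of 0 n i] that by (simp add: Z_def)
  have a0: "a i > 0" if "i < N" for i
    using Z0[OF that] c0 VT by (simp add: a_def add_pos_nonneg)
  \<comment> \<open>The late items: the value seen exceeds \<open>c * V T\<close>. Both sides carry
    another factor \<open>c\<close> to match the regularization and the threshold of
    \<open>sum_increment_ratio_le_ln\<close>.\<close>
  define L where "L = {t. t < T \<and> c * V (Suc t) > c * (c * V T)}"
  have late: "u i / 2 \<le> (\<Sum>t\<in>L. x i t * v i t)" if i: "i < N" for i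
  proof -
    define E where "E = {..<T} - L"
    have "(\<Sum>t\<in>E. x i t * v i t) \<le> c * V T"
    proof (cases "E = {}")
      case True
      then show ?thesis using c0 VT by simp
    next
      case False
      have finE: "finite E" by (simp add: E_def)
      \<comment> \<open>All early items lie among the first \<open>Suc r\<close>, and
        \<open>r\<close> itself is early, so together they are worth at most
        \<open>V (Suc r) <= c * V T\<close>.\<close>
      define r where "r = Max E"
      have r: "r \<in> E" using Max_in[OF finE False] by (simp add: r_def)
      then have rT: "r < T" by (simp add: E_def)
      have xs: "x i t \<le> s t" if "t < T" for t
        using fx member_le_sum[of i "{..<N}" "\<lambda>i. x i t"] that i by (force simp: feasible_def)
      have "(\<Sum>t\<in>E. x i t * v i t) \<le> (\<Sum>t\<in>E. v i t * s t)"
        using xs v0[OF i] by (intro sum_mono) (auto simp: E_def mult.commute[of "x i _"] intro!: mult_left_mono)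
      also have "\<dots> \<le> total_value (Suc r) s v i"
        unfolding total_value_def
        by (rule sum_mono2) (use finE rT s0 v0[OF i] in \<open>auto simp: r_def less_Suc_eq_le\<close>)
      also have "\<dots> \<le> V (Suc r)"
        unfolding V_def
        by (rule member_le_sum) (use rT i s0 v0 in \<open>auto simp: total_value_def simp del: sum.lessThan_Suc intro!: sum_nonneg\<close>)
      also have "\<dots> \<le> c * V T"
        using r rT c0 by (simp add: E_def L_def)
      finally show ?thesis .
    qed
    moreover have "u i = (\<Sum>t\<in>L. x i t * v i t) + (\<Sum>t\<in>E. x i t * v i t)"
      unfolding u_def utility_def E_def
      by (subst add.commute, rule sum.subset_diff) (auto simp: L_def)
    ultimately show ?thesis using cVu[OF i] by linarith
  qed
  \<comment> \<open>Half of the optimal allocation competes with the greedy split of half the item,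
    hence the factor 2.\<close>
  have step: "(\<Sum>i<N. x i t * v i t / U i t) \<le> 2 * (\<Sum>i<N. v i t * z i t / U i t)" if t: "t \<in> L" for t
  proof -
    have tT: "t < T" using t by (simp add: L_def)
    have "c * V (Suc t) > 0"
      using t c0 VT unfolding L_def by (smt (verit) mem_Collect_eq mult_pos_pos)
    then have "base_utility N s v lam z i t > 0" if "i < N" for i
      using Z0[OF that, of t] tT by (simp add: base add_pos_nonneg)
    moreover have "half_split N s t (\<lambda>i. x i t / 2)"
      using fx tT by (simp add: half_split_def feasible_def sum_divide_distrib[symmetric])
    ultimately have "(\<Sum>i<N. v i t * (x i t / 2) / U i t) \<le> (\<Sum>i<N. v i t * z i t / U i t)"
      using greedy_step_first_order[OF g[OF tT]] v0 tT unfolding baseU by blast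
    moreover have "(\<Sum>i<N. v i t * (x i t / 2) / U i t) = (\<Sum>i<N. x i t * v i t / U i t) / 2"
      by (simp add: sum_divide_distrib mult.commute)
    ultimately show ?thesis by simp
  qed
  \<comment> \<open>The logarithm of the range of the regularized utilities: at most
    \<open>c * V T + V T\<close> at the end, against the threshold
    \<open>c * (c * V T)\<close>.\<close>
  define D where "D = ln ((1 + c) / c\<^sup>2)"
  have greedy: "(\<Sum>t\<in>L. v i t * z i t / U i t) \<le> D" if i: "i < N" for i
  proof -
    \<comment> \<open>Truncating at \<open>T\<close> makes both sequences monotone: beyond \<open>T\<close> the values are arbitrary.\<close>
    have "(\<Sum>t\<in>L. v i t * z i t / U i t) = (\<Sum>t | t < T \<and> c * V (min T (Suc t)) > c * (c * V T).
        (Z i (min T (Suc t)) - Z i (min T t)) / (c * V (min T (Suc t)) + Z i (min T (Suc t))))"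
      by (intro sum.cong) (auto simp: L_def U_def Z_def)
    also have "\<dots> \<le> ln ((max (c * V (min T T)) (c * (c * V T)) + Z i (min T T)) / (c * (c * V T)))"
      using c0 VT Vmono Zmono i
      by (intro sum_increment_ratio_le_ln monoI mult_left_mono) (auto simp: Z_def)
    also have "\<dots> \<le> D"
    proof -
      have "2 * lam * (real N)\<^sup>2 \<ge> 2 * 1 * 1"
        using lam N by (intro mult_mono) auto
      then have c1: "c \<le> 1" by (simp add: c_def)
      then have "max (c * V T) (c * (c * V T)) = c * V T"
        using c0 VT by (simp add: max_def)
      moreover have "Z i T \<le> total_value T s v i"
        unfolding Z_def total_value_def by (intro sum_mono mult_left_mono) (use zs v0 i in auto)
      then have "Z i T \<le> V T" using M[OF i] by linarith
      moreover have "(c * V T + V T) / (c * (c * V T)) = (1 + c) / c\<^sup>2"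
        using VT c0 by (simp add: power2_eq_square field_simps)
      ultimately show ?thesis
        unfolding D_def using a0[OF i] c0 VT
        by (simp add: a_def flip: \<open>_ = (1 + c) / c\<^sup>2\<close>) (simp add: divide_right_mono)
    qed
    finally show ?thesis .
  qed
  have Dlam: "D \<le> 9 * ln lam"
  proof -
    have "(1 + c) / c\<^sup>2 = (1 + c) * (2 * lam * (real N)\<^sup>2)\<^sup>2"
      by (simp add: c_def field_simps)
    \<comment> \<open>From \<open>2 <= lam\<close> and \<open>N <= lam\<close>, the reciprocal of
      \<open>c\<close> is at most \<open>lam ^ 4\<close>. Its square, together with
      \<open>1 + c <= 2 <= lam\<close>, gives the ninth power.\<close>
    also have "\<dots> \<le> 2 * (lam * lam * lam\<^sup>2)\<^sup>2"
    proof (intro mult_mono power_mono)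
      have "2 * lam * (real N)\<^sup>2 \<ge> 2 * 1 * 1"
        using lam N by (intro mult_mono) auto
      then show "1 + c \<le> 2" by (simp add: c_def)
    qed (use lam lam0 Nmu c0 in auto)
    also have "\<dots> \<le> lam * (lam * lam * lam\<^sup>2)\<^sup>2"
      using lam by (intro mult_right_mono) auto
    also have "\<dots> = lam ^ 9" by (simp add: power_numeral_reduce)
    finally have "D \<le> ln (lam ^ 9)"
      unfolding D_def using c0 lam0 by (simp add: divide_pos_pos)
    then show ?thesis using lam0 by (simp add: ln_realpow)
  qed
  \<comment> \<open>Each final \<open>a i\<close> dominates \<open>U i t\<close>, so the earlier
    denominators enlarge the terms. Exchanging sums lets \<open>step\<close> act per item, and
    exchanging back lets \<open>greedy\<close> act per agent.\<close>
  have "(\<Sum>i<N. u i / 2 / a i) \<le> (\<Sum>i<N. \<Sum>t\<in>L. x i t * v i t / U i t)"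
  proof (rule sum_mono)
    fix i assume "i \<in> {..<N}"
    then have i: "i < N" by simp
    have "u i / 2 / a i \<le> (\<Sum>t\<in>L. x i t * v i t) / a i"
      using late[OF i] a0[OF i] by (intro divide_right_mono) auto
    also have "\<dots> = (\<Sum>t\<in>L. x i t * v i t / a i)" by (simp add: sum_divide_distrib)
    also have "\<dots> \<le> (\<Sum>t\<in>L. x i t * v i t / U i t)"
    proof (rule sum_mono)
      fix t assume t: "t \<in> L"
      then have tT: "t < T" by (simp add: L_def)
      have "c * V (Suc t) > 0"
        using t c0 VT unfolding L_def by (smt (verit) mem_Collect_eq mult_pos_pos)
      then have "U i t > 0" using Z0[OF i, of "Suc t"] tT by (simp add: U_def add_pos_nonneg)
      moreover have "U i t \<le> a i"
        unfolding U_def a_def using Vmono[of "Suc t" T] Zmono[of "Suc t" T i] tT i c0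
        by (intro add_mono mult_left_mono) auto
      moreover have "x i t * v i t \<ge> 0" using fx v0 i tT by (simp add: feasible_def)
      ultimately show "x i t * v i t / a i \<le> x i t * v i t / U i t"
        by (intro divide_left_mono mult_pos_pos a0 i) auto
    qed
    finally show "u i / 2 / a i \<le> (\<Sum>t\<in>L. x i t * v i t / U i t)" .
  qed
  also have "\<dots> = (\<Sum>t\<in>L. \<Sum>i<N. x i t * v i t / U i t)" by (rule sum.swap)
  also have "\<dots> \<le> (\<Sum>t\<in>L. 2 * (\<Sum>i<N. v i t * z i t / U i t))" by (intro sum_mono step)
  also have "\<dots> = 2 * (\<Sum>i<N. \<Sum>t\<in>L. v i t * z i t / U i t)"
    by (subst sum.swap) (simp add: sum_distrib_left)
  also have "\<dots> \<le> 2 * (\<Sum>i<N. D)"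
    using greedy by (intro mult_left_mono sum_mono) auto
  also have "\<dots> \<le> 18 * real N * ln lam"
    using mult_left_mono[OF Dlam, of "real N"] by (simp add: mult_ac)
  finally have "(\<Sum>i<N. u i / 2 / a i) \<le> 18 * real N * ln lam" .
  moreover have "(\<Sum>i<N. u i / 2 / a i) = (\<Sum>i<N. u i / a i) / 2"
    by (simp add: sum_divide_distrib mult.commute)
  ultimately have "(\<Sum>i<N. u i / a i) \<le> 36 * ln lam * real N" by (simp add: mult_ac)
  then have sum: "(\<Sum>i<N. u i / a i) / real N \<le> 36 * ln lam"
    using N by (simp add: pos_divide_le_eq)
  have "root N (\<Prod>i<N. u i / a i) = (\<Prod>i<N. u i / a i) powr (1 / real N)"
    using N u0 a0 by (intro root_powr_inverse prod_nonneg) (auto intro!: divide_nonneg_pos simp: less_imp_le)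
  also have "\<dots> \<le> (\<Sum>i<N. u i / a i / real N)"
    using arith_geom_mean[of "{..<N}" "\<lambda>i. u i / a i"] N u0 a0 by (auto intro: less_imp_le divide_nonneg_pos)
  also have "\<dots> \<le> 36 * ln lam"
    using sum by (simp add: sum_divide_distrib)
  finally have ratio: "root N (\<Prod>i<N. u i / a i) \<le> 36 * ln lam" .
  have "(\<Prod>i<N. u i) = (\<Prod>i<N. u i / a i * a i)"
    using a0 by (intro prod.cong) (auto simp: less_imp_neq[symmetric])
  also have "\<dots> = (\<Prod>i<N. u i / a i) * (\<Prod>i<N. a i)" by (rule prod.distrib)
  finally have "nash_welfare N T v x = root N (\<Prod>i<N. u i / a i) * root N (\<Prod>i<N. a i)"
    by (simp only: nash_welfare_def u_def real_root_mult)
  also have "\<dots> \<le> 36 * ln lam * nash_welfare N T v y"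
  proof (rule mult_mono[OF ratio])
    show "root N (\<Prod>i<N. a i) \<le> nash_welfare N T v y"
      unfolding nash_welfare_def using N a0 ua
      by (intro real_root_le_mono prod_mono) (auto intro: less_imp_le)
    show "0 \<le> root N (\<Prod>i<N. a i)"
      using a0 by (intro real_root_ge_zero prod_nonneg) (auto intro: less_imp_le)
  qed (use lam in auto)
  finally show ?thesis .
qed

section \<open>Sampling the level\<close>

text \<open>Take the least admissible \<open>k\<close>. Minimality makes \<open>m\<close> exceed the
  previous level, so \<open>2 ^ k * ln 2 <= 2 * ln m\<close>; with
  \<open>k + 1 <= 8 * ln (ln m)\<close> this gives \<open>128 = 8 * 8 * 2\<close>. For
  \<open>k <= 2\<close> the left side is at most 36 and \<open>max 1\<close> absorbs it.\<close>

lemma level_exists: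
  fixes m :: real
  shows "\<exists>k. m \<le> 2 ^ (2 ^ k) \<and>
    (real k + 1)\<^sup>2 * ln (2 ^ (2 ^ k) :: real) \<le> 128 * max 1 (ln m * (ln (ln m))\<^sup>2)"
proof -
  define P where "P k \<longleftrightarrow> m \<le> 2 ^ (2 ^ k)" for k :: nat
  obtain n where n: "m < real n" using reals_Archimedean2 by blast
  also have "real n \<le> 2 ^ n" by (simp add: less_imp_le)
  also have "\<dots> \<le> (2::real) ^ (2 ^ n)" by (intro power_increasing) (auto simp: less_imp_le)
  finally have "P n" by (simp add: P_def)
  define k where "k = (LEAST k. P k)"
  have Pk: "P k" unfolding k_def by (rule LeastI) fact
  have ln_level: "ln (2 ^ (2 ^ j) :: real) = 2 ^ j * ln 2" for j :: nat
    by (simp add: ln_realpow)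
  define R where "R = ln m * (ln (ln m))\<^sup>2"
  have "(real k + 1)\<^sup>2 * (2 ^ k * ln 2) \<le> 128 * max 1 R"
  proof (cases "k \<le> 2")
    case True
    have "(real k + 1)\<^sup>2 \<le> 3\<^sup>2" using True by (intro power_mono) auto
    moreover have "2 ^ k \<le> (2::real) ^ 2" using True by (intro power_increasing) auto
    then have "2 ^ k * ln 2 \<le> (2::real) ^ 2 * 1" using ln_2_less_1 by (intro mult_mono) auto
    ultimately have "(real k + 1)\<^sup>2 * (2 ^ k * ln 2) \<le> 3\<^sup>2 * (2 ^ 2 * 1)"
      by (rule mult_mono) auto
    then show ?thesis by simp
  next
    case False
    then obtain j where k: "k = Suc j" and j: "j \<ge> 2" by (cases k) auto
    have "\<not> P j" using not_less_Least[of j P] k by (simp add: k_def)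
    then have m: "m > 2 ^ (2 ^ j)" by (simp add: P_def)
    have m0: "m > 0" using m by (rule less_trans[rotated]) simp
    have "ln (2 ^ (2 ^ j)) < ln m" using m m0 by (subst ln_less_cancel_iff) auto
    then have l: "2 ^ j * ln 2 < ln m" by (simp add: ln_level)
    have ln2: "ln 2 \<ge> (1 / 2 :: real)" using ln2_ge_two_thirds by simp
    have "2 ^ j * (1 / 2) \<le> 2 ^ j * ln (2::real)" using ln2 by (intro mult_left_mono) auto
    then have l': "2 ^ j * (1 / 2) < ln m" using l by linarith
    have lm0: "ln m > 0" using l' by (rule less_trans[rotated]) simp
    have "2 ^ j * (1 / 2) = (2::real) ^ (j - 1)" using j by (cases j) auto
    then have "ln ((2::real) ^ (j - 1)) < ln (ln m)" using l' lm0 by simp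
    then have "real (j - 1) * ln 2 < ln (ln m)" by (simp add: ln_realpow)
    moreover have "real (j - 1) * (1 / 2) \<le> real (j - 1) * ln 2" using ln2 by (intro mult_left_mono) auto
    ultimately have "real (j - 1) / 2 \<le> ln (ln m)" by simp
    \<comment> \<open>Here \<open>k + 1 = j + 2\<close> is at most \<open>4 * (j - 1)\<close>
      because \<open>j >= 2\<close>; this fixes where the cases split.\<close>
    then have "real k + 1 \<le> 8 * ln (ln m)" using j k by (simp add: of_nat_diff)
    then have "(real k + 1)\<^sup>2 \<le> (8 * ln (ln m))\<^sup>2" by (intro power_mono) auto
    moreover have "2 ^ k * ln 2 \<le> 2 * ln m" using l k by simp
    ultimately have "(real k + 1)\<^sup>2 * (2 ^ k * ln 2) \<le> (8 * ln (ln m))\<^sup>2 * (2 * ln m)"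
      by (rule mult_mono) auto
    also have "\<dots> = 128 * R" by (simp add: R_def power_mult_distrib)
    also have "\<dots> \<le> 128 * max 1 R" by simp
    finally show ?thesis .
  qed
  then show ?thesis using Pk by (auto simp: ln_level P_def R_def)
qed

text \<open>One level is kept and the others contribute nonnegatively. Integrability must be shown,
  since the expectation of a non-integrable function is 0 by convention.\<close>

lemma randomized_half_and_half_expectation:
  assumes inst: "nw_instance N T s v" and X: "\<And>k. half_and_half N T s v (2 ^ (2 ^ k)) (X k)"
  shows "pmf level_pmf k * nash_welfare N T v (X k)
    \<le> measure_pmf.expectation (map_pmf X level_pmf) (nash_welfare N T v)"
proof -
  define f where "f = (\<lambda>j. nash_welfare N T v (X j))"
  have fX: "feasible N T s (X j)" for j by (rule half_and_half_feasible[OF inst X])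
  have f0: "f j \<ge> 0" for j unfolding f_def by (rule nash_welfare_nonneg[OF inst fX])
  have "integrable level_pmf f"
    by (rule measure_pmf.integrable_const_bound[where B = "root N (\<Prod>i<N. total_value T s v i)"])
       (use f0 nash_welfare_bound[OF inst fX] in \<open>auto simp: f_def\<close>)
  then have "measure_pmf.expectation level_pmf (\<lambda>j. indicator {k} j * f k) \<le> measure_pmf.expectation level_pmf f"
    by (intro integral_mono integrable_mult_left integrable_real_indicator)
       (auto simp: f0 indicator_def less_top[symmetric])
  then show ?thesis by (simp add: f_def measure_pmf_single)
qed

(* max 1 makes the bound meaningful for all instances: the iterated logarithm vanishes at
   exp 1, and the ratio log(\<mu>* N) is 0 for a single agent.  For \<mu>* N \<ge> exp (exp 1)
   the maximum is attained by the second argument. *)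
theorem theorem3:
  shows "\<exists>C>0. competitive randomized_half_and_half
           (\<lambda>N T s v. let m = impartiality_ratio N T s v * real N
                      in C * max 1 (ln m * (ln (ln m))\<^sup>2))"
proof -
  \<comment> \<open>The factors are the loss at a fixed parameter, the loss in choosing the level,
    and the inverse of the normalizing constant of \<open>level_pmf\<close>.\<close>
  define C :: real where "C = 36 * 128 * (pi\<^sup>2 / 6)"
  have C: "C > 0" by (simp add: C_def)
  have "opt_nash_welfare N T s v
      \<le> C * max 1 (ln m * (ln (ln m))\<^sup>2) * measure_pmf.expectation p (nash_welfare N T v)"
    if inst: "nw_instance N T s v" and p: "randomized_half_and_half N T s v p"
      and m: "m = impartiality_ratio N T s v * real N" for N T s v p m
  proof -
    obtain X where X: "\<And>k. half_and_half N T s v (2 ^ (2 ^ k)) (X k)" and pX: "p = map_pmf X level_pmf"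
      using p by (auto simp: randomized_half_and_half_def)
    define E where "E = measure_pmf.expectation p (nash_welfare N T v)"
    note expect = randomized_half_and_half_expectation[OF inst X, folded pX, folded E_def]
    have fX: "feasible N T s (X k)" for k by (rule half_and_half_feasible[OF inst X])
    have nonneg: "nash_welfare N T v (X k) \<ge> 0" for k by (rule nash_welfare_nonneg[OF inst fX])
    obtain x where x: "nash_maximizing N T s v x" using nash_maximizing_exists[OF inst] by blast
    then have fx: "feasible N T s x" by (simp add: nash_maximizing_def)
    define B where "B = max 1 (ln m * (ln (ln m))\<^sup>2)"
    have B: "B \<ge> 1" by (simp add: B_def)
    have "nash_welfare N T v x \<le> C * B * E"
    proof (cases "\<forall>i<N. total_value T s v i > 0")
      case True
      then have pos: "\<And>i. i < N \<Longrightarrow> total_value T s v i > 0" by blast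
      obtain k where k: "m \<le> 2 ^ (2 ^ k)" "(real k + 1)\<^sup>2 * ln (2 ^ (2 ^ k) :: real) \<le> 128 * B"
        using level_exists unfolding B_def by blast
      have two: "(2::real) \<le> 2 ^ (2 ^ k)" using power_increasing[of 1 "2 ^ k" "2::real"] by simp
      define w where "w = nash_welfare N T v (X k)"
      have "nash_welfare N T v x \<le> 36 * ln (2 ^ (2 ^ k)) * w"
        unfolding w_def
        by (rule half_and_half_nash_welfare[OF inst pos x impartiality_ratio[OF inst pos] two _ X])
           (use k(1) m in auto)
      also have "\<dots> = 36 * (pi\<^sup>2 / 6) * ((real k + 1)\<^sup>2 * ln (2 ^ (2 ^ k))) * (pmf level_pmf k * w)"
        by (simp add: pmf_level_pmf field_simps)
      also have "\<dots> \<le> 36 * (pi\<^sup>2 / 6) * (128 * B) * E"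
      proof (rule mult_mono)
        show "36 * (pi\<^sup>2 / 6) * ((real k + 1)\<^sup>2 * ln (2 ^ (2 ^ k))) \<le> 36 * (pi\<^sup>2 / 6) * (128 * B)"
          by (rule mult_left_mono[OF k(2)]) simp
      qed (use expect[of k] nonneg[of k] B in \<open>auto simp: w_def\<close>)
      finally show ?thesis by (simp add: C_def)
    next
      case False
      \<comment> \<open>Some agent values nothing, so the optimum is 0. The impartiality ratio is
        unspecified here, but \<open>B >= 1\<close> holds for any \<open>m\<close>.\<close>
      then obtain i where i: "i < N" "total_value T s v i \<le> 0" by force
      then have "utility T v x i = 0"
        using utility_le_total_value[OF inst fx i(1)] utility_nonneg[OF inst fx i(1)] by simp
      then have "(\<Prod>i<N. utility T v x i) = 0" using i(1) by (intro prod_zero) auto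
      then have "nash_welfare N T v x = 0" by (simp add: nash_welfare_def del: prod_zero_iff)
      moreover have "E \<ge> 0"
        using order_trans[OF mult_nonneg_nonneg[OF pmf_nonneg nonneg] expect] .
      ultimately show ?thesis using B C by simp
    qed
    then show ?thesis by (simp add: opt_nash_welfare_eq[OF x] B_def E_def)
  qed
  then show ?thesis
    using C unfolding competitive_def Let_def by blast
qed

end
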